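(* Let three reciprocal two-port elements have scattering matrices $\mathbf{S}_n = \begin{bmatrix} A_n & B_n \\ B_n & D_n \end{bmatrix}$, $n=1,2,3$, and let their inner ports be connected to ports 1, 2, 3, respectively, of an ideal circulator with scattering matrix $$\mathbf{S}_{\mathrm{circ}} = \begin{bmatrix} 0 & 0 & 1\\ 1 & 0 & 0\\ 0 & 1 & 0 \end{bmatrix}.$$ Then the scattering matrix $\mathbf{\Phi}$ of the resulting three-element group is non-symmetric and is given by $$\mathbf{\Phi} = \begin{bmatrix} A_1 + B_1^2D_2D_3/\Delta & B_1B_2D_3/\Delta & B_1B_3/\Delta \\ B_1B_2/\Delta & A_2 + B_2^2D_1D_3/\Delta & B_2B_3D_1/\Delta \\ B_1B_3D_2/\Delta & B_2B_3/\Delta & A_3 + B_3^2D_1D_2/\Delta \end{bmatrix},$$ where $\Delta = 1 - D_1D_2D_3$.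
   Context: Each element $n$ is a two-port with an outer port (interacting with free space) and an inner port (connected to the circulator). It is characterized by a symmetric (reciprocal) $2\times 2$ impedance matrix $\mathbf{Z}_n$, and its scattering matrix is $\mathbf{S}_n = (\mathbf{Z}_n - Z_0\mathbf{I})(\mathbf{Z}_n+Z_0\mathbf{I})^{-1}$, where $Z_0$ is the free-space impedance; it is written $\mathbf{S}_n = \begin{bmatrix} A_n & B_n \\ B_n & D_n\end{bmatrix}$. Let $a_n, b_n$ be the waves incident on, respectively leaving, element $n$ at its outer port, and let $a_{n0}, b_{n0}$ be the waves incident on, respectively leaving, element $n$ at its inner port, so that $$\begin{bmatrix} b_n \\ b_{n0}\end{bmatrix} = \mathbf{S}_n \begin{bmatrix} a_n \\ a_{n0}\end{bmatrix},\qquad n=1,2,3.$$ The circulator receives $b_{10}, b_{20}, b_{30}$ at its ports 1, 2, 3 and emits $a_{10}, a_{20}, a_{30}$: $[a_{10},a_{20},a_{30}]^{\mathrm T} = \mathbf{S}_{\mathrm{circ}}\,[b_{10},b_{20},b_{30}]^{\mathrm T}$, i.e. $a_{10}=b_{30}$, $a_{20}=b_{10}$, $a_{30}=b_{20}$. The scattering matrix $\mathbf{\Phi}$ of the group is the $3\times 3$ matrix relating the outer waves when these relations hold, $[b_1,b_2,b_3]^{\mathrm T} = \mathbf{\Phi}\,[a_1,a_2,a_3]^{\mathrm T}$; its entries are $[\mathbf{\Phi}]_{mn} = b_m/a_n$ evaluated with $a_k=0$ for all $k\neq n$. A matrix is non-symmetric if it differs from its transpose.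
   Formalization: Δ ≠ 0 is assumed; "Φ is non-symmetric", which fails e.g. when all B_n = 0, is replaced by the exact criterion: Φ is non-symmetric iff B_iB_j ≠ 0 and D_k ≠ 1 for some {i,j,k} = {1,2,3}. *)

theory Defs
  imports "HOL-Analysis.Analysis"
begin

definition scattering_matrix :: "real \<Rightarrow> complex^2^2 \<Rightarrow> complex^2^2" where
  "scattering_matrix Z0 Z =
     (Z - mat (complex_of_real Z0)) ** matrix_inv (Z + mat (complex_of_real Z0))"

definition S_circ :: "complex^3^3" where
  "S_circ = vector [vector [0, 0, 1],
                    vector [1, 0, 0],
                    vector [0, 1, 0]]"

text \<open>
  Elements are indexed by the three-element type \<^typ>\<open>3\<close>. In each two-port, index 1 is the outer
  port and index 2 the inner port. The vectors \<open>a\<close>, \<open>b\<close> collect the incident and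
  outgoing waves at the outer ports, \<open>a0\<close>, \<open>b0\<close> those at the inner ports, where
  incident and outgoing are always meant with respect to the elements.
\<close>

definition group_waves ::
    "(3 \<Rightarrow> complex^2^2) \<Rightarrow> complex^3 \<Rightarrow> complex^3 \<Rightarrow> complex^3 \<Rightarrow> complex^3 \<Rightarrow> bool" where
  "group_waves S a b a0 b0 \<longleftrightarrow>
     (\<forall>n. vector [b $ n, b0 $ n] = S n *v vector [a $ n, a0 $ n]) \<and>
     a0 = S_circ *v b0"

text \<open>
  The right-to-left direction of the equivalence requires every outer excitation \<open>a\<close> to
  be compatible with the connection, so that no matrix qualifies vacuously.
\<close>

definition is_group_scattering_matrix :: "(3 \<Rightarrow> complex^2^2) \<Rightarrow> complex^3^3 \<Rightarrow> bool" where
  "is_group_scattering_matrix S \<Phi> \<longleftrightarrow>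
     (\<forall>a b. (\<exists>a0 b0. group_waves S a b a0 b0) \<longleftrightarrow> b = \<Phi> *v a)"

lemma group_scattering_matrix_entry:
  assumes "is_group_scattering_matrix S \<Phi>" and "group_waves S a b a0 b0"
    and "a $ n \<noteq> 0" and "\<And>k. k \<noteq> n \<Longrightarrow> a $ k = 0"
  shows "\<Phi> $ m $ n = b $ m / a $ n"
proof -
  have "b = \<Phi> *v a"
    using assms(1,2) unfolding is_group_scattering_matrix_def by blast
  then have "b $ m = (\<Sum>k\<in>UNIV. \<Phi> $ m $ k * a $ k)"
    by (simp add: matrix_vector_mult_def)
  also have "\<dots> = (\<Sum>k\<in>UNIV. if k = n then \<Phi> $ m $ n * a $ n else 0)"
    by (rule sum.cong) (use assms(4) in auto)
  also have "\<dots> = \<Phi> $ m $ n * a $ n" by simp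
  finally show ?thesis using assms(3) by simp
qed

end

theory Submission
  imports Defs
begin

text \<open>
  Around the circulator loop the waves leaving the inner ports satisfy
  \<open>b\<^sub>1\<^sub>0 = B\<^sub>1 a\<^sub>1 + D\<^sub>1 b\<^sub>3\<^sub>0\<close> and its cyclic shifts. Substituting once around the loop gives
  \<open>\<Delta> b\<^sub>3\<^sub>0 = B\<^sub>3 a\<^sub>3 + D\<^sub>3 B\<^sub>2 a\<^sub>2 + D\<^sub>3 D\<^sub>2 B\<^sub>1 a\<^sub>1\<close>, so for \<open>\<Delta> \<noteq> 0\<close> every excitation determines the
  inner waves, and hence \<open>b\<^sub>n = A\<^sub>n a\<^sub>n + B\<^sub>n a\<^sub>n\<^sub>0\<close>.
\<close>

text \<open>\<open>\<Delta>\<close> is a separate argument because the symmetry criterion uses only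
  that it is nonzero.\<close>

definition group_matrix ::
    "(3 \<Rightarrow> complex) \<Rightarrow> (3 \<Rightarrow> complex) \<Rightarrow> (3 \<Rightarrow> complex) \<Rightarrow> complex \<Rightarrow> complex^3^3" where
  "group_matrix A B D \<Delta> = vector
     [vector [A 1 + (B 1)\<^sup>2 * D 2 * D 3 / \<Delta>, B 1 * B 2 * D 3 / \<Delta>, B 1 * B 3 / \<Delta>],
      vector [B 1 * B 2 / \<Delta>, A 2 + (B 2)\<^sup>2 * D 1 * D 3 / \<Delta>, B 2 * B 3 * D 1 / \<Delta>],
      vector [B 1 * B 3 * D 2 / \<Delta>, B 2 * B 3 / \<Delta>, A 3 + (B 3)\<^sup>2 * D 1 * D 2 / \<Delta>]]"

text \<open>The system has determinant \<open>1 - d1 * d2 * d3\<close>. In each numerator a source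
  \<open>ui\<close> carries the reflection factors met on its way round the loop.\<close>

lemma cyclic_affine_system_iff:
  fixes u1 u2 u3 d1 d2 d3 x1 x2 x3 :: "'a::field"
  assumes "1 - d1 * d2 * d3 \<noteq> 0"
  shows "x1 = u1 + d1 * x3 \<and> x2 = u2 + d2 * x1 \<and> x3 = u3 + d3 * x2 \<longleftrightarrow>
    x1 = (u1 + d1 * u3 + d1 * d3 * u2) / (1 - d1 * d2 * d3) \<and>
    x2 = (u2 + d2 * u1 + d1 * d2 * u3) / (1 - d1 * d2 * d3) \<and>
    x3 = (u3 + d3 * u2 + d2 * d3 * u1) / (1 - d1 * d2 * d3)" (is "?L \<longleftrightarrow> ?R")
proof
  assume ?L
  then have "x1 * (1 - d1 * d2 * d3) = u1 + d1 * u3 + d1 * d3 * u2"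
    "x2 * (1 - d1 * d2 * d3) = u2 + d2 * u1 + d1 * d2 * u3"
    "x3 * (1 - d1 * d2 * d3) = u3 + d3 * u2 + d2 * d3 * u1"
    by algebra+
  then show ?R using assms by (simp add: eq_divide_eq)
next
  assume ?R
  then have "x1 * (1 - d1 * d2 * d3) = u1 + d1 * u3 + d1 * d3 * u2"
    "x2 * (1 - d1 * d2 * d3) = u2 + d2 * u1 + d1 * d2 * u3"
    "x3 * (1 - d1 * d2 * d3) = u3 + d3 * u2 + d2 * d3 * u1"
    using assms by simp_all
  \<comment> \<open>Scaling each loop equation by the determinant makes it a polynomial consequence
    of the closed forms; the nonzero factor then cancels.\<close>
  then have "x1 * (1 - d1 * d2 * d3) = (u1 + d1 * x3) * (1 - d1 * d2 * d3)"
    "x2 * (1 - d1 * d2 * d3) = (u2 + d2 * x1) * (1 - d1 * d2 * d3)"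
    "x3 * (1 - d1 * d2 * d3) = (u3 + d3 * x2) * (1 - d1 * d2 * d3)"
    by algebra+
  then show ?L using assms by simp
qed

text \<open>The circulator permutation eliminates \<open>a0\<close>. The middle block is grouped to
  match \<open>cyclic_affine_system_iff\<close> with \<open>un = B n * a $ n\<close> and
  \<open>dn = D n\<close>.\<close>

lemma group_waves_iff:
  assumes "\<And>n. S n = vector [vector [A n, B n], vector [B n, D n]]"
  shows "group_waves S a b a0 b0 \<longleftrightarrow>
    a0 = vector [b0 $ 3, b0 $ 1, b0 $ 2] \<and>
    (b0 $ 1 = B 1 * a $ 1 + D 1 * b0 $ 3 \<and> b0 $ 2 = B 2 * a $ 2 + D 2 * b0 $ 1 \<and>
      b0 $ 3 = B 3 * a $ 3 + D 3 * b0 $ 2) \<and>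
    b = vector [A 1 * a $ 1 + B 1 * b0 $ 3, A 2 * a $ 2 + B 2 * b0 $ 1,
      A 3 * a $ 3 + B 3 * b0 $ 2]"
proof -
  have "S_circ *v b0 = vector [b0 $ 3, b0 $ 1, b0 $ 2]"
    by (simp add: S_circ_def vec_eq_iff forall_3 matrix_vector_mult_def sum_3)
  moreover have "vector [b $ n, b0 $ n] = S n *v vector [a $ n, a0 $ n] \<longleftrightarrow>
      b $ n = A n * a $ n + B n * a0 $ n \<and> b0 $ n = B n * a $ n + D n * a0 $ n" for n
    by (simp add: assms vec_eq_iff forall_2 matrix_vector_mult_def sum_2)
  moreover have "b = vector [y1, y2, y3] \<longleftrightarrow> b $ 1 = y1 \<and> b $ 2 = y2 \<and> b $ 3 = y3" for y1 y2 y3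
    by (simp add: vec_eq_iff forall_3)
  ultimately show ?thesis
    unfolding group_waves_def forall_3 by (metis vector_3)
qed

lemma is_group_scattering_matrix_group_matrix:
  assumes S: "\<And>n. S n = vector [vector [A n, B n], vector [B n, D n]]"
    and \<Delta>: "\<Delta> = 1 - D 1 * D 2 * D 3" "\<Delta> \<noteq> 0"
  shows "is_group_scattering_matrix S (group_matrix A B D \<Delta>)"
  unfolding is_group_scattering_matrix_def
proof (intro allI)
  fix a b :: "complex^3"
  \<comment> \<open>These are the solved values of \<open>b0 $ 1\<close>, \<open>b0 $ 2\<close>,
    \<open>b0 $ 3\<close>.\<close>
  define x1 where "x1 = (B 1 * a $ 1 + D 1 * (B 3 * a $ 3) + D 1 * D 3 * (B 2 * a $ 2)) / \<Delta>"
  define x2 where "x2 = (B 2 * a $ 2 + D 2 * (B 1 * a $ 1) + D 1 * D 2 * (B 3 * a $ 3)) / \<Delta>"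
  define x3 where "x3 = (B 3 * a $ 3 + D 3 * (B 2 * a $ 2) + D 2 * D 3 * (B 1 * a $ 1)) / \<Delta>"
  \<comment> \<open>Now \<open>a\<close> fixes all other waves, so the existential over
    \<open>a0\<close> and \<open>b0\<close> collapses.\<close>
  have "group_waves S a b a0 b0 \<longleftrightarrow>
      a0 = vector [x3, x1, x2] \<and> b0 = vector [x1, x2, x3] \<and>
      b = vector [A 1 * a $ 1 + B 1 * x3, A 2 * a $ 2 + B 2 * x1, A 3 * a $ 3 + B 3 * x2]" for a0 b0
    unfolding group_waves_iff[OF S] cyclic_affine_system_iff[OF \<Delta>(2)[unfolded \<Delta>(1)]]
      \<Delta>(1)[symmetric] x1_def[symmetric] x2_def[symmetric] x3_def[symmetric]
    by (auto simp: vec_eq_iff forall_3)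
  moreover have "group_matrix A B D \<Delta> *v a =
      vector [A 1 * a $ 1 + B 1 * x3, A 2 * a $ 2 + B 2 * x1, A 3 * a $ 3 + B 3 * x2]"
    using \<Delta>(2) unfolding x1_def x2_def x3_def group_matrix_def
    by (simp add: vec_eq_iff forall_3 matrix_vector_mult_def sum_3 field_simps power2_eq_square)
  ultimately show "(\<exists>a0 b0. group_waves S a b a0 b0) \<longleftrightarrow> b = group_matrix A B D \<Delta> *v a"
    by simp
qed

lemma is_group_scattering_matrix_unique:
  assumes "is_group_scattering_matrix S \<Phi>" "is_group_scattering_matrix S \<Psi>"
  shows "\<Phi> = \<Psi>"
  using assms unfolding is_group_scattering_matrix_def matrix_eq by blast

text \<open>Opposite entries differ by one factor \<open>D k\<close>: one direction passes straight
  through the circulator, the other reflects at the third element \<open>k\<close>.\<close>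

lemma group_matrix_nonsymmetric_iff:
  assumes "\<Delta> \<noteq> 0"
  shows "group_matrix A B D \<Delta> \<noteq> transpose (group_matrix A B D \<Delta>) \<longleftrightarrow>
    (B 1 * B 2 \<noteq> 0 \<and> D 3 \<noteq> 1) \<or> (B 2 * B 3 \<noteq> 0 \<and> D 1 \<noteq> 1) \<or> (B 1 * B 3 \<noteq> 0 \<and> D 2 \<noteq> 1)"
  using assms unfolding group_matrix_def
  by (auto simp: vec_eq_iff forall_3 transpose_def)

text \<open>Non-symmetry is stated as a criterion because \<open>\<Phi>\<close> is diagonal when all
  \<open>B n\<close> vanish.\<close>

theorem theorem3:
  fixes Z0 :: real
    and Z S :: "3 \<Rightarrow> complex^2^2"
    and A B D :: "3 \<Rightarrow> complex"
    and \<Delta> :: complex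
  assumes "Z0 > 0"
    and "\<And>n. transpose (Z n) = Z n"
    and "\<And>n. invertible (Z n + mat (complex_of_real Z0))"
    and "\<And>n. S n = scattering_matrix Z0 (Z n)"
    and "\<And>n. S n = vector [vector [A n, B n],
                            vector [B n, D n]]"
    and "\<Delta> = 1 - D 1 * D 2 * D 3"
    and "\<Delta> \<noteq> 0"
  shows "(\<exists>!\<Phi>. is_group_scattering_matrix S \<Phi>) \<and>
    (\<forall>\<Phi>. is_group_scattering_matrix S \<Phi> \<longrightarrow>
      (\<Phi> \<noteq> transpose \<Phi> \<longleftrightarrow>
         (B 1 * B 2 \<noteq> 0 \<and> D 3 \<noteq> 1) \<or>
         (B 2 * B 3 \<noteq> 0 \<and> D 1 \<noteq> 1) \<or>
         (B 1 * B 3 \<noteq> 0 \<and> D 2 \<noteq> 1)) \<and>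
      \<Phi> = vector
        [vector [A 1 + (B 1)\<^sup>2 * D 2 * D 3 / \<Delta>, B 1 * B 2 * D 3 / \<Delta>, B 1 * B 3 / \<Delta>],
         vector [B 1 * B 2 / \<Delta>, A 2 + (B 2)\<^sup>2 * D 1 * D 3 / \<Delta>, B 2 * B 3 * D 1 / \<Delta>],
         vector [B 1 * B 3 * D 2 / \<Delta>, B 2 * B 3 / \<Delta>, A 3 + (B 3)\<^sup>2 * D 1 * D 2 / \<Delta>]])"
proof -
  have "is_group_scattering_matrix S (group_matrix A B D \<Delta>)"
    using assms(5-7) by (rule is_group_scattering_matrix_group_matrix)
  then show ?thesis
    using is_group_scattering_matrix_unique group_matrix_nonsymmetric_iff[OF assms(7)]
    unfolding group_matrix_def[symmetric] by metis
qed

end
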